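(* Let $n\in\mathbb{N}$. The ghost algebra $\mathrm{Gh}_n$ with parameters $\beta,\alpha_1,\alpha_2,\alpha_3,\delta_1,\delta_2,\delta_3,\gamma_{12},\gamma_3$ is isomorphic to the label algebra $\mathcal{L}_n(X)$ with $X=\{0,1\}$, the same $\beta$, and $$\alpha^{10}=\alpha_1,\quad \alpha^{01}=\alpha_2,\quad \alpha^{11}=\alpha^{00}=\alpha_3,$$ $$\delta_{10}=\delta_1,\quad \delta_{01}=\delta_2,\quad \delta_{11}=\delta_{00}=\delta_3,$$ $$\gamma^1_0=\gamma^0_1=\gamma_{12},\quad \gamma^1_1=\gamma^0_0=\gamma_3 .$$
   Context: $\mathbb{N}$ is the set of positive integers. Let $K=\mathbb{C}(\beta,\alpha_1,\alpha_2,\alpha_3,\delta_1,\delta_2,\delta_3,\gamma_{12},\gamma_3)$ with the listed parameters independent indeterminates; both algebras are over $K$. **Ghost algebra $\mathrm{Gh}_n$.** A $\mathrm{Gh}_n$-diagram is a rectangle with $n$ nodes on each of its left and right sides and with top and bottom boundaries. Non-crossing strings are drawn inside; each string connects a node to another node or to a boundary, and each node has exactly one string endpoint attached. The string endpoints on each boundary partition it into regions called domains; each domain may contain finitely many dots called ghosts. On each boundary the number of string endpoints plus ghosts must be even. Two diagrams are equal if their strings connect the same nodes to each other or to the same boundary, and the numbers of ghosts in corresponding domains agree modulo $2$. $\mathrm{Gh}_n$ is the $K$-vector space with basis all $\mathrm{Gh}_n$-diagrams. To multiply two diagrams $D_1D_2$, concatenate them ($D_1$ left of $D_2$, joining right node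 $i$ of $D_1$ to left node $i$ of $D_2$). Number the string endpoints and ghosts along each boundary of the concatenation from left to right starting at $1$. Each loop is removed for a factor $\beta$. Each boundary arc (string with both ends on boundaries) is removed, leaving a ghost at each of its endpoints, for a factor determined by the parities of its endpoints' numbers: both ends on top: $\alpha_1$ if (left end, right end) is (odd, even), $\alpha_2$ if (even, odd), $\alpha_3$ if the parities are equal; both ends on the bottom: $\delta_1$ if (odd, even), $\delta_2$ if (even, odd), $\delta_3$ if equal; one end on each boundary: $\gamma_{12}$ if the parities differ, $\gamma_3$ if they are equal. The result is a scalar multiple of a $\mathrm{Gh}_n$-diagram; extend bilinearly. **Label algebra $\mathcal{L}_n(X)$.** An $\mathcal{L}_n(X)$-diagram is a rectangle with $n$ nodes on each of its left and right sides and top and bottom boundaries, with non-crossing strings inside, each connecting a node to another node or to a boundary, each node having exactly one string endpoint attached, and each string endpoint on a boundary carrying a label from $X$ (no ghosts and no parity condition). Two diagrams are equal if their strings connect the same nodes to each other or to the same boundary, and corresponding boundary endpoints have the same labels. $\mathcal{L}_n(X)$ is the $K$-vector space with basis all $\mathcal{L}_n(X)$-diagrams. To multiply two diagrams $D_1D_2$, concatenate them ($D_1$ left of $D_2$, joining right node $i$ of $D_1$ to left node $i$ of $D_2$), with all boundary endpoints keeping their labels, then remove each loop for a factor $\beta$ and each boundary arc (string with both ends on boundaries; no ghosts are left behind) for the factor: $\alpha^{ab}$ if both ends are on top with labels $a$ (left), $b$ (right); $\delta_{ab}$ if both ends are on the bottom with labels $a$ (left), $b$ (right); $\gamma^a_b$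 if it has a top end labelled $a$ and a bottom end labelled $b$. The result is a scalar multiple of an $\mathcal{L}_n(X)$-diagram; extend bilinearly. *)

theory Defs
  imports
    Complex_Main
    "HOL-Algebra.QuotRing"
    "HOL-Algebra.Module"
    "HOL-Computational_Algebra.Fraction_Field"
    "HOL-Library.Poly_Mapping"
begin

subsection \<open>The ground field\<close>

datatype param = Beta | Alpha1 | Alpha2 | Alpha3 | Delta1 | Delta2 | Delta3 | Gamma12 | Gamma3

text \<open>The order on \<^typ>\<open>param\<close> is irrelevant; the library asks for one in order to know that
  polynomials with these indeterminates form an integral domain.\<close>

primrec param_index :: "param \<Rightarrow> nat" where
  "param_index Beta = 0"
| "param_index Alpha1 = 1"
| "param_index Alpha2 = 2"
| "param_index Alpha3 = 3"
| "param_index Delta1 = 4"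
| "param_index Delta2 = 5"
| "param_index Delta3 = 6"
| "param_index Gamma12 = 7"
| "param_index Gamma3 = 8"

lemma param_index_inject: "param_index p = param_index q \<Longrightarrow> p = q"
  by (cases p; cases q) simp_all

instantiation param :: linorder
begin

definition less_eq_param :: "param \<Rightarrow> param \<Rightarrow> bool" where
  "p \<le> q \<longleftrightarrow> param_index p \<le> param_index q"

definition less_param :: "param \<Rightarrow> param \<Rightarrow> bool" where
  "p < q \<longleftrightarrow> param_index p < param_index q"

instance
  by standard (auto simp: less_eq_param_def less_param_def intro: param_index_inject)

end

text \<open>The field of rational functions over the complex numbers: exponent vectors are
  \<^typ>\<open>param \<Rightarrow>\<^sub>0 nat\<close>, and polynomials are finitely supported functions on these.\<close>

type_synonym ground = "((param \<Rightarrow>\<^sub>0 nat) \<Rightarrow>\<^sub>0 complex) fract"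

definition indet :: "param \<Rightarrow> ground" where
  "indet p = Fract (Poly_Mapping.single (Poly_Mapping.single p 1) 1) 1"

subsection \<open>Diagrams\<close>

text \<open>The nodes on each side are numbered \<open>1, \<dots>, n\<close> from top to bottom.\<close>

datatype node = Lft nat | Rgt nat

definition nodes :: "nat \<Rightarrow> node set" where
  "nodes n = Lft ` {1..n} \<union> Rgt ` {1..n}"

text \<open>Both kinds of diagram are instances of one type. Each boundary is recorded as the word of
  things met on it from left to right: a ghost, or the end of a string whose other end is at the
  given node, carrying a label. The strings joining two nodes are recorded as a set of
  two-element sets.\<close>

datatype 'x item = Ghost | End node (label: 'x)

datatype 'x diagram =
  Diagram (links: "node set set") (top_word: "'x item list") (bot_word: "'x item list")

text \<open>\<open>Top k\<close> and \<open>Bot k\<close> are the places of the \<open>k\<close>-th letters (from \<open>0\<close>) of the boundary words.\<close>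

datatype point = Node node | Top nat | Bot nat

definition strings :: "'x diagram \<Rightarrow> point set set" where
  "strings D =
     {{Node u, Node v} | u v. {u, v} \<in> links D} \<union>
     {{Node v, Top k} | v k x. k < length (top_word D) \<and> top_word D ! k = End v x} \<union>
     {{Node v, Bot k} | v k x. k < length (bot_word D) \<and> bot_word D ! k = End v x}"

text \<open>The order of the points clockwise around the rectangle, beginning with the lowest node on
  the left. The bottom boundary is traversed from right to left.\<close>

primrec pos :: "nat \<Rightarrow> 'x diagram \<Rightarrow> point \<Rightarrow> nat" where
  "pos n D (Node v) =
     (case v of Lft i \<Rightarrow> n - i | Rgt i \<Rightarrow> n + length (top_word D) + i)"
| "pos n D (Top k) = n + k"
| "pos n D (Bot k) = 2 * n + length (top_word D) + length (bot_word D) - k"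

definition noncrossing :: "nat \<Rightarrow> 'x diagram \<Rightarrow> bool" where
  "noncrossing n D \<longleftrightarrow>
     \<not> (\<exists>a b c d. {a, b} \<in> strings D \<and> {c, d} \<in> strings D \<and>
          pos n D a < pos n D c \<and> pos n D c < pos n D b \<and> pos n D b < pos n D d)"

definition is_diagram :: "nat \<Rightarrow> 'x diagram \<Rightarrow> bool" where
  "is_diagram n D \<longleftrightarrow>
     links D \<subseteq> {{u, v} | u v. u \<in> nodes n \<and> v \<in> nodes n \<and> u \<noteq> v} \<and>
     (\<forall>v x. End v x \<in> set (top_word D) \<union> set (bot_word D) \<longrightarrow> v \<in> nodes n) \<and>
     (\<forall>v \<in> nodes n. \<exists>!s. s \<in> strings D \<and> Node v \<in> s) \<and>
     noncrossing n D"

text \<open>Ghosts count modulo \<open>2\<close> in each domain, so each class of equal ghost diagrams is represented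
  by the one having at most one ghost in each domain, i.e. no two consecutive ghosts.
  String ends of ghost diagrams carry no information, hence the label type \<^typ>\<open>unit\<close>.\<close>

definition ghost_reduced :: "'x item list \<Rightarrow> bool" where
  "ghost_reduced w \<longleftrightarrow> (\<forall>k. Suc k < length w \<longrightarrow> \<not> (w ! k = Ghost \<and> w ! Suc k = Ghost))"

definition ghost_diagrams :: "nat \<Rightarrow> unit diagram set" where
  "ghost_diagrams n = {D. is_diagram n D \<and>
     even (length (top_word D)) \<and> even (length (bot_word D)) \<and>
     ghost_reduced (top_word D) \<and> ghost_reduced (bot_word D)}"

definition label_diagrams :: "nat \<Rightarrow> 'x set \<Rightarrow> 'x diagram set" where
  "label_diagrams n X = {D. is_diagram n D \<and>
     set (top_word D) \<union> set (bot_word D) \<subseteq> {End v x | v x. x \<in> X}}"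

fun cancel_ghosts :: "'x item list \<Rightarrow> 'x item list" where
  "cancel_ghosts [] = []"
| "cancel_ghosts (End v x # w) = End v x # cancel_ghosts w"
| "cancel_ghosts (Ghost # w) =
     (case cancel_ghosts w of Ghost # w' \<Rightarrow> w' | w' \<Rightarrow> Ghost # w')"

subsection \<open>Concatenation\<close>

text \<open>The points of the concatenation of \<open>D\<^sub>1\<close> and \<open>D\<^sub>2\<close> are those of \<open>D\<^sub>1\<close> (tagged \<^const>\<open>Inl\<close>) and of
  \<open>D\<^sub>2\<close> (tagged \<^const>\<open>Inr\<close>). The nodes that get identified are instead joined by an extra edge.\<close>

definition cat_edges :: "nat \<Rightarrow> 'x diagram \<Rightarrow> 'x diagram \<Rightarrow> (point + point) set set" where
  "cat_edges n D1 D2 =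
     (image Inl) ` strings D1 \<union> (image Inr) ` strings D2 \<union>
     {{Inl (Node (Rgt i)), Inr (Node (Lft i))} | i. i \<in> {1..n}}"

definition cat_conn :: "nat \<Rightarrow> 'x diagram \<Rightarrow> 'x diagram \<Rightarrow> (point + point) rel" where
  "cat_conn n D1 D2 = {(p, q). {p, q} \<in> cat_edges n D1 D2}\<^sup>*"

text \<open>The curves of the concatenation: loops, boundary arcs, and strings ending at an outer node.\<close>

definition cat_curves :: "nat \<Rightarrow> 'x diagram \<Rightarrow> 'x diagram \<Rightarrow> (point + point) set set" where
  "cat_curves n D1 D2 = \<Union> (cat_edges n D1 D2) // cat_conn n D1 D2"

primrec outer :: "node \<Rightarrow> point + point" where
  "outer (Lft i) = Inl (Node (Lft i))"
| "outer (Rgt i) = Inr (Node (Rgt i))"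

definition cat_top :: "'x diagram \<Rightarrow> 'x diagram \<Rightarrow> (point + point) list" where
  "cat_top D1 D2 = map (\<lambda>k. Inl (Top k)) [0..<length (top_word D1)] @
                   map (\<lambda>k. Inr (Top k)) [0..<length (top_word D2)]"

definition cat_bot :: "'x diagram \<Rightarrow> 'x diagram \<Rightarrow> (point + point) list" where
  "cat_bot D1 D2 = map (\<lambda>k. Inl (Bot k)) [0..<length (bot_word D1)] @
                   map (\<lambda>k. Inr (Bot k)) [0..<length (bot_word D2)]"

definition ends_on :: "(point + point) set \<Rightarrow> (point + point) list \<Rightarrow> nat list" where
  "ends_on c ps = filter (\<lambda>i. ps ! i \<in> c) [0..<length ps]"

text \<open>The factor contributed by a curve. The functions \<open>a\<close>, \<open>d\<close>, \<open>g\<close> give the factors of boundary arcs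
  in terms of the places of their ends in the words of the concatenation, counted from \<open>0\<close>; for \<open>a\<close>
  and \<open>d\<close> the left end is the first argument, for \<open>g\<close> the top end.\<close>

definition curve_factor ::
  "'k::field \<Rightarrow> (nat \<Rightarrow> nat \<Rightarrow> 'k) \<Rightarrow> (nat \<Rightarrow> nat \<Rightarrow> 'k) \<Rightarrow> (nat \<Rightarrow> nat \<Rightarrow> 'k) \<Rightarrow>
   'x diagram \<Rightarrow> 'x diagram \<Rightarrow> (point + point) set \<Rightarrow> 'k" where
  "curve_factor \<beta> a d g D1 D2 c =
     (if \<exists>v. outer v \<in> c then 1
      else (case (ends_on c (cat_top D1 D2), ends_on c (cat_bot D1 D2)) of
              ([], []) \<Rightarrow> \<beta>
            | ([i, j], []) \<Rightarrow> a i j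
            | ([], [i, j]) \<Rightarrow> d i j
            | ([i], [j]) \<Rightarrow> g i j
            | _ \<Rightarrow> 1))"

text \<open>\<open>r\<close> is what a removed boundary arc leaves behind at each of its ends.\<close>

definition resolve ::
  "nat \<Rightarrow> 'x item list \<Rightarrow> 'x diagram \<Rightarrow> 'x diagram \<Rightarrow> point + point \<Rightarrow> 'x item \<Rightarrow> 'x item list" where
  "resolve n r D1 D2 p t =
     (case t of
        Ghost \<Rightarrow> [Ghost]
      | End u x \<Rightarrow>
          if \<exists>v. (p, outer v) \<in> cat_conn n D1 D2
          then [End (THE v. (p, outer v) \<in> cat_conn n D1 D2) x]
          else r)"

definition cat_diagram :: "nat \<Rightarrow> 'x item list \<Rightarrow> 'x diagram \<Rightarrow> 'x diagram \<Rightarrow> 'x diagram" where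
  "cat_diagram n r D1 D2 = Diagram
     {{u, v} | u v. u \<in> nodes n \<and> v \<in> nodes n \<and> u \<noteq> v \<and> (outer u, outer v) \<in> cat_conn n D1 D2}
     (concat (map2 (resolve n r D1 D2) (cat_top D1 D2) (top_word D1 @ top_word D2)))
     (concat (map2 (resolve n r D1 D2) (cat_bot D1 D2) (bot_word D1 @ bot_word D2)))"

definition id_diagram :: "nat \<Rightarrow> 'x diagram" where
  "id_diagram n = Diagram {{Lft i, Rgt i} | i. i \<in> {1..n}} [] []"

subsection \<open>The algebras\<close>

text \<open>The vector space with basis \<open>B\<close>, with the bilinear multiplication given on basis elements by
  \<open>D\<^sub>1 D\<^sub>2 = c D\<^sub>1 D\<^sub>2 \<cdot> m D\<^sub>1 D\<^sub>2\<close> and with unit the basis element \<open>e\<close>.\<close>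

definition based_algebra ::
  "'d set \<Rightarrow> 'd \<Rightarrow> ('d \<Rightarrow> 'd \<Rightarrow> 'd) \<Rightarrow> ('d \<Rightarrow> 'd \<Rightarrow> 'k::field) \<Rightarrow> ('k, 'd \<Rightarrow>\<^sub>0 'k) module" where
  "based_algebra B e m c =
     \<lparr>carrier = {f. Poly_Mapping.keys f \<subseteq> B},
      mult = (\<lambda>f g. \<Sum>x \<in> Poly_Mapping.keys f. \<Sum>y \<in> Poly_Mapping.keys g.
                Poly_Mapping.single (m x y)
                  (Poly_Mapping.lookup f x * Poly_Mapping.lookup g y * c x y)),
      one = Poly_Mapping.single e 1,
      zero = 0,
      add = (+),
      smult = (\<lambda>s. Poly_Mapping.map (\<lambda>t. s * t))\<rparr>"

text \<open>In the concatenation, the item at place \<open>i\<close> (counted from \<open>0\<close>) has number \<open>Suc i\<close>.\<close>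

definition parity_factor :: "'k \<Rightarrow> 'k \<Rightarrow> 'k \<Rightarrow> nat \<Rightarrow> nat \<Rightarrow> 'k" where
  "parity_factor odd_even even_odd equal i j =
     (if odd (Suc i) \<and> even (Suc j) then odd_even
      else if even (Suc i) \<and> odd (Suc j) then even_odd
      else equal)"

definition ghost_algebra ::
  "nat \<Rightarrow> 'k::field \<Rightarrow> 'k \<Rightarrow> 'k \<Rightarrow> 'k \<Rightarrow> 'k \<Rightarrow> 'k \<Rightarrow> 'k \<Rightarrow> 'k \<Rightarrow> 'k \<Rightarrow> ('k, unit diagram \<Rightarrow>\<^sub>0 'k) module"
where
  "ghost_algebra n \<beta> \<alpha>1 \<alpha>2 \<alpha>3 \<delta>1 \<delta>2 \<delta>3 \<gamma>12 \<gamma>3 =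
     based_algebra (ghost_diagrams n) (id_diagram n)
       (\<lambda>D1 D2. let D = cat_diagram n [Ghost] D1 D2
                in Diagram (links D) (cancel_ghosts (top_word D)) (cancel_ghosts (bot_word D)))
       (\<lambda>D1 D2. \<Prod>c \<in> cat_curves n D1 D2.
          curve_factor \<beta>
            (parity_factor \<alpha>1 \<alpha>2 \<alpha>3)
            (parity_factor \<delta>1 \<delta>2 \<delta>3)
            (parity_factor \<gamma>12 \<gamma>12 \<gamma>3) D1 D2 c)"

definition label_algebra ::
  "nat \<Rightarrow> 'x set \<Rightarrow> 'k::field \<Rightarrow> ('x \<Rightarrow> 'x \<Rightarrow> 'k) \<Rightarrow> ('x \<Rightarrow> 'x \<Rightarrow> 'k) \<Rightarrow> ('x \<Rightarrow> 'x \<Rightarrow> 'k) \<Rightarrow>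
   ('k, 'x diagram \<Rightarrow>\<^sub>0 'k) module"
where
  "label_algebra n X \<beta> \<alpha> \<delta> \<gamma> =
     based_algebra (label_diagrams n X) (id_diagram n)
       (cat_diagram n [])
       (\<lambda>D1 D2.
          let t = (\<lambda>i. label ((top_word D1 @ top_word D2) ! i));
              b = (\<lambda>i. label ((bot_word D1 @ bot_word D2) ! i))
          in \<Prod>c \<in> cat_curves n D1 D2.
               curve_factor \<beta>
                 (\<lambda>i j. \<alpha> (t i) (t j)) (\<lambda>i j. \<delta> (b i) (b j)) (\<lambda>i j. \<gamma> (t i) (b j)) D1 D2 c)"

definition algebra_isomorphic :: "('k, 'a) module \<Rightarrow> ('k, 'b) module \<Rightarrow> bool" where
  "algebra_isomorphic A B \<longleftrightarrow>
     (\<exists>\<phi> \<in> ring_iso A B. \<forall>s. \<forall>x \<in> carrier A. \<phi> (s \<odot>\<^bsub>A\<^esub> x) = s \<odot>\<^bsub>B\<^esub> \<phi> x)"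

end

theory Submission
  imports Defs
begin

text \<open>Number the letters of each boundary word of a ghost diagram from 1, label every string end by
  the parity of its number and forget the ghosts. As the words have even length and no two
  consecutive ghosts, the labels determine the ghosts, so this is a bijection between the two
  bases. Evenness also means that numbers keep their parity in a concatenation; so do the
  replacement of a boundary arc by two ghosts and the cancellation of neighbouring ghosts.
  Hence the bijection respects products, and the factors of boundary arcs agree.\<close>

subsection \<open>Words\<close>

text \<open>A reduced word has at most one ghost in each domain, so one comparison decides whether
  it is there: the label of the next end against the parity of the number due or, after the last
  end, the evenness of the total length. The obstacle is that points are places in the boundary
  words, and deleting ghosts moves the places. The move is the rank map \<open>end_rank\<close>,
  which is strictly increasing on the places of ends but not injective on all places. Strings,
  cyclic order, connected components and curves on the label side are therefore obtained as images
  of those on the ghost side, and each such step rests on injectivity on actual string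
  points.\<close>

fun parity_word :: "nat \<Rightarrow> 'x item list \<Rightarrow> nat item list" where
  "parity_word k [] = []"
| "parity_word k (Ghost # w) = parity_word (Suc k) w"
| "parity_word k (End v x # w) = End v (k mod 2) # parity_word (Suc k) w"

text \<open>Here \<open>k\<close> is the number due to the next letter. A mismatch between
  \<open>k\<close> and the label reveals a forgotten ghost; at the end of the word an even
  \<open>k\<close> means that an odd number of letters precedes, counting from 1, so one ghost is
  missing. Label words contain no \<open>Ghost\<close>; skipping it keeps the lemmas on reducedness
  and length unconditional.\<close>

fun ghost_word :: "nat \<Rightarrow> nat item list \<Rightarrow> unit item list" where
  "ghost_word k [] = (if odd k then [] else [Ghost])"
| "ghost_word k (Ghost # w) = ghost_word k w"
| "ghost_word k (End v y # w) =
     (if k mod 2 = y then End v () # ghost_word (Suc k) w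
      else Ghost # End v () # ghost_word (Suc (Suc k)) w)"

lemma ex_nat_iff: "(\<exists>k. P k) \<longleftrightarrow> P 0 \<or> (\<exists>k. P (Suc k))"
  by (metis not0_implies_Suc)

lemma parity_word_Suc_Suc: "parity_word (Suc (Suc k)) w = parity_word k w"
proof (induction w arbitrary: k)
  case (Cons t w)
  then show ?case by (cases t) simp_all
qed simp

lemma parity_word_add_even: "even m \<Longrightarrow> parity_word (m + k) w = parity_word k w"
proof (induction m rule: less_induct)
  case (less m)
  show ?case
  proof (cases "m = 0")
    case False
    with less.prems obtain l where "m = Suc (Suc l)" "even l"
      by (metis even_Suc not0_implies_Suc even_zero)
    with less.IH[of l] show ?thesis by (simp add: parity_word_Suc_Suc)
  qed simp
qed

lemma parity_word_append:
  "parity_word k (w @ w') = parity_word k w @ parity_word (length w + k) w'"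
proof (induction w arbitrary: k)
  case (Cons t w)
  then show ?case by (cases t) simp_all
qed simp

text \<open>A cancelled pair takes up two numbers, so later ends keep their parity. The start
  \<open>k\<close> is arbitrary because the tail is numbered from \<open>Suc k\<close>.\<close>

lemma parity_word_cancel_ghosts: "parity_word k (cancel_ghosts w) = parity_word k w"
proof (induction w arbitrary: k rule: cancel_ghosts.induct)
  case (3 w)
  show ?case
  proof (cases "cancel_ghosts w")
    case Nil
    with 3[of "Suc k"] show ?thesis by simp
  next
    case (Cons t w')
    with 3[of "Suc k"] show ?thesis by (cases t) (simp_all add: parity_word_Suc_Suc)
  qed
qed simp_all

lemma ghost_reduced_Nil [simp]: "ghost_reduced []"
  by (simp add: ghost_reduced_def)

lemma ghost_reduced_Cons [simp]:
  "ghost_reduced (t # w) \<longleftrightarrow> ghost_reduced w \<and> (t = Ghost \<longrightarrow> w = [] \<or> hd w \<noteq> Ghost)"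
proof -
  have "\<not> ghost_reduced (t # w) \<longleftrightarrow>
      (\<exists>k. k < length w \<and> (t # w) ! k = Ghost \<and> w ! k = Ghost)"
    by (auto simp: ghost_reduced_def)
  also have "\<dots> \<longleftrightarrow> (w \<noteq> [] \<and> t = Ghost \<and> hd w = Ghost) \<or> \<not> ghost_reduced w"
    by (subst ex_nat_iff) (cases w; auto simp: ghost_reduced_def)
  finally show ?thesis by blast
qed

text \<open>The parity condition is evenness of the length when \<open>k = 1\<close>, in a form that
  is invariant when a letter is removed and \<open>k\<close> is raised.\<close>

lemma ghost_word_parity_word:
  assumes "ghost_reduced w" "odd (length w + k)"
  shows "ghost_word k (parity_word k w) = w"
  using assms
proof (induction w arbitrary: k)
  case (Cons t w)
  show ?case
  proof (cases t)
    case Ghost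
    show ?thesis
    \<comment> \<open>A forgotten ghost is restored only on meeting what follows it, so the
      induction looks one letter ahead. Reducedness makes that letter an end, whose label mismatches
      \<open>k\<close>.\<close>
    proof (cases w)
      case Nil
      with Ghost Cons.prems show ?thesis by simp
    next
      case (Cons s w')
      then obtain v x where "s = End v x" using Ghost Cons.prems by (cases s) auto
      with Ghost Cons Cons.IH[of "Suc k"] Cons.prems show ?thesis
        by (auto simp: mod2_eq_if split: if_splits)
    qed
  next
    case (End v x)
    with Cons.IH[of "Suc k"] Cons.prems show ?thesis by simp
  qed
qed simp

text \<open>Of two consecutive numbers one has the prescribed parity, so inserting at most one ghost
  before an end gives it its label back.\<close>

lemma parity_word_ghost_word:
  assumes "set w \<subseteq> {End v y | v y. y \<in> {0, 1}}"
  shows "parity_word k (ghost_word k w) = w"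
  using assms
proof (induction w arbitrary: k)
  case (Cons t w)
  then show ?case by (auto simp: mod2_eq_if)
qed simp

lemma ghost_word_reduced:
  "ghost_reduced (ghost_word k w)"
proof (induction k w rule: ghost_word.induct)
  case (3 k v y w)
  then show ?case by auto
qed simp_all

text \<open>For \<open>k = 1\<close> this is the even length demanded of ghost diagrams.\<close>

lemma odd_length_ghost_word: "odd (length (ghost_word k w) + k)"
  by (induction k w rule: ghost_word.induct) auto

lemma in_set_parity_word:
  "t \<in> set (parity_word k w) \<Longrightarrow> \<exists>v y. t = End v y \<and> (y = 0 \<or> y = Suc 0)"
proof (induction k w rule: parity_word.induct)
  case (3 k v x w)
  then show ?case by (auto simp: mod2_eq_if)
qed simp_all

lemma End_in_parity_word: "(\<exists>y. End v y \<in> set (parity_word k w)) \<longleftrightarrow> (\<exists>x. End v x \<in> set w)"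
proof (induction w arbitrary: k)
  case (Cons t w)
  then show ?case by (cases t) auto
qed simp

section \<open>Places of string ends before and after forgetting ghosts\<close>

definition end_rank :: "'x item list \<Rightarrow> nat \<Rightarrow> nat" where
  "end_rank w k = length (filter (\<lambda>t. t \<noteq> Ghost) (take k w))"

text \<open>The domain on which \<open>end_rank\<close> is injective: a ghost has the same rank as
  the letter after it.\<close>

definition end_places :: "'x item list \<Rightarrow> nat set" where
  "end_places w = {k. k < length w \<and> w ! k \<noteq> Ghost}"

lemma end_rank_simps [simp]:
  "end_rank w 0 = 0"
  "end_rank (Ghost # w) (Suc k) = end_rank w k"
  "end_rank (End v x # w) (Suc k) = Suc (end_rank w k)"
  by (simp_all add: end_rank_def)

text \<open>The end at \<open>k\<close> itself is counted for \<open>l\<close> but not for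
  \<open>k\<close>. As \<open>l\<close> need not be a place of an end, \<open>l = length w\<close>
  yields the bound on ranks by the length of the parity word.\<close>

lemma end_rank_less:
  assumes "k \<in> end_places w" "k < l"
  shows "end_rank w k < end_rank w l"
proof -
  have "take l w = take k w @ w ! k # drop (Suc k) (take l w)"
    using assms id_take_nth_drop[of k "take l w"] by (simp add: end_places_def)
  from arg_cong[OF this, of "\<lambda>u. length (filter (\<lambda>t. t \<noteq> Ghost) u)"]
  show ?thesis using assms by (simp add: end_rank_def end_places_def)
qed

lemma end_rank_less_iff:
  assumes "k \<in> end_places w" "l \<in> end_places w"
  shows "end_rank w k < end_rank w l \<longleftrightarrow> k < l"
  using assms end_rank_less by (metis less_asym linorder_neqE_nat)

lemma inj_on_end_rank: "inj_on (end_rank w) (end_places w)"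
  by (rule inj_onI) (metis end_rank_less less_irrefl linorder_neqE_nat)

lemma length_parity_word: "length (parity_word k w) = end_rank w (length w)"
proof (induction w arbitrary: k)
  case (Cons t w)
  then show ?case by (cases t) simp_all
qed simp

lemma end_rank_less_length: "k \<in> end_places w \<Longrightarrow> end_rank w k < length (parity_word j w)"
  unfolding length_parity_word by (rule end_rank_less) (simp_all add: end_places_def)

text \<open>The labels are quantified away because strings do not see them; what remains says that
  the ends at \<open>v\<close> move exactly by rank.\<close>

lemma parity_word_nth_iff:
  "(\<exists>y. l < length (parity_word j w) \<and> parity_word j w ! l = End v y) \<longleftrightarrow>
   (\<exists>k x. k < length w \<and> w ! k = End v x \<and> l = end_rank w k)"
proof (induction w arbitrary: j l)
  case (Cons t w)
  show ?case
  proof (cases t)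
    case Ghost
    have "(\<exists>k x. k < length (t # w) \<and> (t # w) ! k = End v x \<and> l = end_rank (t # w) k) \<longleftrightarrow>
        (\<exists>k x. k < length w \<and> w ! k = End v x \<and> l = end_rank w k)"
      unfolding Ghost by (subst ex_nat_iff) simp
    with Cons.IH[of l "Suc j"] Ghost show ?thesis by simp
  next
    case (End u x)
    have "(\<exists>k x. k < length (t # w) \<and> (t # w) ! k = End v x \<and> l = end_rank (t # w) k) \<longleftrightarrow>
        (l = 0 \<and> u = v) \<or> (\<exists>k x. k < length w \<and> w ! k = End v x \<and> l = Suc (end_rank w k))"
      unfolding End by (subst ex_nat_iff) auto
    \<comment> \<open>All ends after the first have positive rank, so \<open>l = 0\<close> leaves
      only the first one, and a positive \<open>l\<close> is handled by the hypothesis at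
      \<open>l - 1\<close>.\<close>
    with Cons.IH[of "l - 1" "Suc j"] End show ?thesis by (cases l) auto
  qed
qed simp

text \<open>The counterpart of forgetting ghosts for a list that runs parallel to a word, such as
  \<open>cat_top\<close> beside the concatenated top words.\<close>

definition at_ends :: "'a list \<Rightarrow> 'x item list \<Rightarrow> 'a list" where
  "at_ends ps w = map fst (filter (\<lambda>(p, t). t \<noteq> Ghost) (zip ps w))"

lemma at_ends_simps [simp]:
  "at_ends [] [] = []"
  "at_ends (p # ps) (Ghost # w) = at_ends ps w"
  "at_ends (p # ps) (End v x # w) = p # at_ends ps w"
  by (simp_all add: at_ends_def)

lemma at_ends_append:
  "length ps = length w \<Longrightarrow> at_ends (ps @ qs) (w @ w') = at_ends ps w @ at_ends qs w'"
  by (simp add: at_ends_def)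

lemma at_ends_map: "at_ends (map f ps) w = map f (at_ends ps w)"
  by (simp add: at_ends_def zip_map1 filter_map o_def case_prod_unfold)

text \<open>Read from left to right, the ends have ranks 0, 1, 2 and so on. Lists of places on the
  label side can thus be written as images of lists on the ghost side.\<close>

lemma map_end_rank_at_ends:
  "map (end_rank w) (at_ends [0..<length w] w) = [0..<length (parity_word k w)]"
proof (induction w arbitrary: k)
  case (Cons t w)
  have upt: "[0..<length (t # w)] = 0 # map Suc [0..<length w]"
    by (simp add: map_Suc_upt upt_conv_Cons del: upt_Suc)
  show ?case
  proof (cases t)
    case Ghost
    with Cons.IH[of "Suc k"] show ?thesis
      unfolding upt by (simp add: at_ends_map o_def)
  next
    case (End v x)
    have "map (end_rank (t # w)) (at_ends [0..<length (t # w)] (t # w)) =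
        0 # map Suc (map (end_rank w) (at_ends [0..<length w] w))"
      unfolding upt using End by (simp add: at_ends_map o_def)
    also have "\<dots> = [0..<length (parity_word k (t # w))]"
      unfolding Cons.IH[of "Suc k"] using End
      by (simp add: map_Suc_upt upt_conv_Cons del: upt_Suc)
    finally show ?thesis .
  qed
qed (simp add: at_ends_def)

lemma map_at_ends_parity_word:
  "map (\<lambda>k. f (end_rank w k)) (at_ends [0..<length w] w) = map f [0..<length (parity_word k w)]"
  by (subst map_end_rank_at_ends[symmetric]) (simp add: o_def)

subsection \<open>Diagrams\<close>

definition parity_diagram :: "unit diagram \<Rightarrow> nat diagram" where
  "parity_diagram D =
     Diagram (links D) (parity_word 1 (top_word D)) (parity_word 1 (bot_word D))"

definition ghosted_diagram :: "nat diagram \<Rightarrow> unit diagram" where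
  "ghosted_diagram D =
     Diagram (links D) (ghost_word 1 (top_word D)) (ghost_word 1 (bot_word D))"

lemma parity_diagram_sel [simp]:
  "links (parity_diagram D) = links D"
  "top_word (parity_diagram D) = parity_word 1 (top_word D)"
  "bot_word (parity_diagram D) = parity_word 1 (bot_word D)"
  by (simp_all add: parity_diagram_def)

section \<open>Strings and their cyclic order\<close>

primrec point_rank :: "'x diagram \<Rightarrow> point \<Rightarrow> point" where
  "point_rank D (Node v) = Node v"
| "point_rank D (Top k) = Top (end_rank (top_word D) k)"
| "point_rank D (Bot k) = Bot (end_rank (bot_word D) k)"

definition string_points :: "'x diagram \<Rightarrow> point set" where
  "string_points D =
     range Node \<union> Top ` end_places (top_word D) \<union> Bot ` end_places (bot_word D)"

lemma string_points_iff [simp]: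
  "Node v \<in> string_points D"
  "Top k \<in> string_points D \<longleftrightarrow> k \<in> end_places (top_word D)"
  "Bot k \<in> string_points D \<longleftrightarrow> k \<in> end_places (bot_word D)"
  by (auto simp: string_points_def)

lemma inj_on_point_rank: "inj_on (point_rank D) (string_points D)"
  unfolding string_points_def
  by (auto intro!: inj_onI dest: inj_onD[OF inj_on_end_rank])

lemma strings_subset: "s \<in> strings D \<Longrightarrow> s \<subseteq> string_points D"
  by (auto simp: strings_def end_places_def)

lemma strings_parity_diagram: "strings (parity_diagram D) = image (point_rank D) ` strings D"
proof -
  \<comment> \<open>With \<open>c\<close> standing for \<open>Top\<close> or \<open>Bot\<close>,
    both boundaries are treated at once. The label quantifier is moved inwards to fit
    \<open>parity_word_nth_iff\<close>.\<close>
  have word: "{{Node v, c l} | v l y. l < length (parity_word 1 w) \<and> parity_word 1 w ! l = End v y} =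
      {{Node v, c (end_rank w k)} | v k x. k < length w \<and> w ! k = End v x}"
    for c :: "nat \<Rightarrow> point" and w :: "unit item list"
  proof -
    have "{{Node v, c l} | v l y. l < length (parity_word 1 w) \<and> parity_word 1 w ! l = End v y} =
        {{Node v, c l} | v l. \<exists>y. l < length (parity_word 1 w) \<and> parity_word 1 w ! l = End v y}"
      by blast
    also have "\<dots> = {{Node v, c (end_rank w k)} | v k x. k < length w \<and> w ! k = End v x}"
      unfolding parity_word_nth_iff by blast
    finally show ?thesis .
  qed
  have image3: "f ` {g u v | u v x. P u v x} = {f (g u v) | u v x. P u v x}"
    for f :: "point set \<Rightarrow> point set" and g and P :: "node \<Rightarrow> nat \<Rightarrow> unit \<Rightarrow> bool"
    by blast
  have image2: "f ` {g u v | u v. P u v} = {f (g u v) | u v. P u v}"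
    for f :: "point set \<Rightarrow> point set" and g and P :: "node \<Rightarrow> node \<Rightarrow> bool"
    by blast
  show ?thesis
    unfolding strings_def parity_diagram_sel image_Un word image3 image2 by simp
qed

text \<open>The positions change with the word lengths, but left side, top, right side and bottom
  still occupy disjoint ranges in this order, and ranks preserve the order within a boundary. For
  nodes outside \<open>nodes n\<close> the ranges may overlap: \<open>Lft 0\<close> shares its
  position with \<open>Top 0\<close>.\<close>

lemma pos_point_rank_less_iff:
  assumes "p \<in> string_points D" "q \<in> string_points D"
    and "\<And>v. Node v \<in> {p, q} \<Longrightarrow> v \<in> nodes n"
  shows "pos n (parity_diagram D) (point_rank D p) < pos n (parity_diagram D) (point_rank D q) \<longleftrightarrow>
    pos n D p < pos n D q"
proof -
  let ?D = "parity_diagram D"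
  have place: "k < length w \<and> end_rank w k < length (parity_word 1 w)"
    if "k \<in> end_places w" for k and w :: "unit item list"
    using that end_rank_less_length by (auto simp: end_places_def)
  have node: "v \<in> nodes n" if "Node v = p \<or> Node v = q" for v
    using that assms(3) by auto
  have ok: "case r of
        Node (Lft i) \<Rightarrow> 1 \<le> i \<and> i \<le> n
      | Node (Rgt i) \<Rightarrow> 1 \<le> i \<and> i \<le> n
      | Top k \<Rightarrow> k < length (top_word D) \<and> end_rank (top_word D) k < length (top_word ?D)
      | Bot k \<Rightarrow> k < length (bot_word D) \<and> end_rank (bot_word D) k < length (bot_word ?D)"
    if "r = p \<or> r = q" for r
  proof (cases r)
    case (Node v)
    with that node[of v] show ?thesis by (auto simp: nodes_def)
  qed (use that assms(1,2) place in auto)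
  have top: "\<forall>k l. p = Top k \<longrightarrow> q = Top l \<longrightarrow>
      (end_rank (top_word D) k < end_rank (top_word D) l \<longleftrightarrow> k < l)"
    using assms(1,2) by (auto simp: end_rank_less_iff)
  \<comment> \<open>The bottom is traversed from right to left, so the comparison is
    reversed.\<close>
  have bot: "\<forall>k l. p = Bot k \<longrightarrow> q = Bot l \<longrightarrow>
      (end_rank (bot_word D) l < end_rank (bot_word D) k \<longleftrightarrow> l < k)"
    using assms(1,2) by (auto simp: end_rank_less_iff)
  show ?thesis
    using ok[of p] ok[of q] top bot
    by (cases p; cases q) (auto split: node.splits)
qed

text \<open>An edge is an unordered pair, so its preimage may have to be turned around for its ends
  to match \<open>a\<close> and \<open>b\<close> in this order.\<close>

lemma doubleton_in_image_image:
  assumes "{a, b} \<in> image f ` S" and "\<forall>s\<in>S. \<exists>p q. s = {p, q}"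
  obtains p q where "{p, q} \<in> S" "a = f p" "b = f q"
proof -
  from assms(1) obtain s where s: "{a, b} = f ` s" "s \<in> S" by (rule imageE)
  with assms(2) obtain p q where pq: "s = {p, q}" by blast
  from s(1) have "{a, b} = {f p, f q}" unfolding pq by simp
  then consider "a = f p" "b = f q" | "a = f q" "b = f p"
    by (auto simp: doubleton_eq_iff)
  then show thesis
  proof cases
    case 1
    with s(2) pq that show thesis by simp
  next
    case 2
    with s(2) pq that[of q p] show thesis by (simp add: insert_commute)
  qed
qed

lemma ex1_image_iff:
  assumes "inj_on f S"
  shows "(\<exists>!y. y \<in> f ` S \<and> P y) \<longleftrightarrow> (\<exists>!x. x \<in> S \<and> P (f x))"
proof
  assume *: "\<exists>!y. y \<in> f ` S \<and> P y"
  then obtain x where x: "x \<in> S" "P (f x)" by blast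
  show "\<exists>!x. x \<in> S \<and> P (f x)"
  proof (rule ex1I[of _ x])
    fix y assume y: "y \<in> S \<and> P (f y)"
    with * x have "f y = f x" by blast
    with assms x y show "y = x" by (blast dest: inj_onD)
  qed (use x in blast)
qed blast

lemma strings_doubleton: "\<forall>s\<in>strings D. \<exists>p q. s = {p, q}"
  by (auto simp: strings_def)

lemma string_nodes:
  assumes "links D \<subseteq> {{u, v} | u v. u \<in> nodes n \<and> v \<in> nodes n \<and> u \<noteq> v}"
    and "\<forall>v x. End v x \<in> set (top_word D) \<union> set (bot_word D) \<longrightarrow> v \<in> nodes n"
    and "s \<in> strings D" "Node v \<in> s"
  shows "v \<in> nodes n"
proof -
  from assms(3) consider
    (link) u w where "s = {Node u, Node w}" "{u, w} \<in> links D"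
  | (top) u k x where "s = {Node u, Top k}" "k < length (top_word D)" "top_word D ! k = End u x"
  | (bot) u k x where "s = {Node u, Bot k}" "k < length (bot_word D)" "bot_word D ! k = End u x"
    unfolding strings_def by blast
  then show ?thesis
  proof cases
    case link
    with assms(1) obtain u' w' where "{u, w} = {u', w'}" "u' \<in> nodes n" "w' \<in> nodes n"
      by blast
    with link assms(4) show ?thesis by (auto simp: doubleton_eq_iff)
  next
    case top
    with assms(4) have "End v x \<in> set (top_word D)" by (auto dest: nth_mem)
    with assms(2) show ?thesis by blast
  next
    case bot
    with assms(4) have "End v x \<in> set (bot_word D)" by (auto dest: nth_mem)
    with assms(2) show ?thesis by blast
  qed
qed

text \<open>Only the clauses of \<open>is_diagram\<close> that place string nodes in
  \<open>nodes n\<close> are assumed. These are available as the earlier conjuncts when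
  \<open>is_diagram\<close> is rewritten with \<open>conj_cong\<close>.\<close>

lemma noncrossing_parity_diagram:
  assumes "links D \<subseteq> {{u, v} | u v. u \<in> nodes n \<and> v \<in> nodes n \<and> u \<noteq> v}"
    and "\<forall>v x. End v x \<in> set (top_word D) \<union> set (bot_word D) \<longrightarrow> v \<in> nodes n"
  shows "noncrossing n (parity_diagram D) \<longleftrightarrow> noncrossing n D"
proof -
  let ?r = "point_rank D" and ?D = "parity_diagram D"
  have less: "pos n ?D (?r p) < pos n ?D (?r q) \<longleftrightarrow> pos n D p < pos n D q"
    if "s \<in> strings D" "t \<in> strings D" "p \<in> s" "q \<in> t" for p q s t
  proof (rule pos_point_rank_less_iff)
    show "p \<in> string_points D" "q \<in> string_points D"
      using that strings_subset by blast+
    show "v \<in> nodes n" if "Node v \<in> {p, q}" for v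
      using that \<open>p \<in> s\<close> \<open>q \<in> t\<close> string_nodes[OF assms \<open>s \<in> strings D\<close>, of v]
        string_nodes[OF assms \<open>t \<in> strings D\<close>, of v] by auto
  qed
  have crossing: "pos n ?D (?r a) < pos n ?D (?r c) \<and> pos n ?D (?r c) < pos n ?D (?r b) \<and>
        pos n ?D (?r b) < pos n ?D (?r d) \<longleftrightarrow>
      pos n D a < pos n D c \<and> pos n D c < pos n D b \<and> pos n D b < pos n D d"
    if ab: "{a, b} \<in> strings D" and cd: "{c, d} \<in> strings D" for a b c d
    using less[OF ab cd, of a c] less[OF cd ab, of c b] less[OF ab cd, of b d] by simp
  have "(\<exists>a b c d. {a, b} \<in> strings ?D \<and> {c, d} \<in> strings ?D \<and>
        pos n ?D a < pos n ?D c \<and> pos n ?D c < pos n ?D b \<and> pos n ?D b < pos n ?D d) \<longleftrightarrow>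
      (\<exists>a b c d. {a, b} \<in> strings D \<and> {c, d} \<in> strings D \<and>
        pos n D a < pos n D c \<and> pos n D c < pos n D b \<and> pos n D b < pos n D d)"
    (is "?L \<longleftrightarrow> ?R")
  proof
    assume ?L
    then obtain a b c d where ab: "{a, b} \<in> image ?r ` strings D"
      and cd: "{c, d} \<in> image ?r ` strings D"
      and pos: "pos n ?D a < pos n ?D c \<and> pos n ?D c < pos n ?D b \<and> pos n ?D b < pos n ?D d"
      unfolding strings_parity_diagram by blast
    obtain a' b' where ab': "{a', b'} \<in> strings D" "a = ?r a'" "b = ?r b'"
      using doubleton_in_image_image[OF ab strings_doubleton] .
    obtain c' d' where cd': "{c', d'} \<in> strings D" "c = ?r c'" "d = ?r d'"
      using doubleton_in_image_image[OF cd strings_doubleton] .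
    have "pos n D a' < pos n D c' \<and> pos n D c' < pos n D b' \<and> pos n D b' < pos n D d'"
      using pos crossing[OF ab'(1) cd'(1)] unfolding ab'(2,3) cd'(2,3) by (rule iffD1[rotated])
    with ab'(1) cd'(1) show ?R by iprover
  next
    assume ?R
    then obtain a b c d where ab: "{a, b} \<in> strings D" and cd: "{c, d} \<in> strings D"
      and pos: "pos n D a < pos n D c \<and> pos n D c < pos n D b \<and> pos n D b < pos n D d"
      by iprover
    have "{?r a, ?r b} \<in> strings ?D" "{?r c, ?r d} \<in> strings ?D"
      using imageI[OF ab, of "image ?r"] imageI[OF cd, of "image ?r"]
      by (simp_all add: strings_parity_diagram)
    with iffD2[OF crossing[OF ab cd] pos] show ?L by iprover
  qed
  then show ?thesis unfolding noncrossing_def by simp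
qed

text \<open>The equivalence serves the bijection in both directions:
  \<open>ghosted_diagram D\<close> is a diagram because its parity diagram is
  \<open>D\<close>.\<close>

lemma is_diagram_parity_diagram: "is_diagram n (parity_diagram D) \<longleftrightarrow> is_diagram n D"
proof -
  have nodes: "(\<forall>v x. End v x \<in> set (top_word (parity_diagram D)) \<union> set (bot_word (parity_diagram D)) \<longrightarrow>
      v \<in> nodes n) \<longleftrightarrow>
    (\<forall>v x. End v x \<in> set (top_word D) \<union> set (bot_word D) \<longrightarrow> v \<in> nodes n)"
    (is "?nodes' \<longleftrightarrow> ?nodes")
  proof -
    have "?nodes' \<longleftrightarrow> (\<forall>v. (\<exists>x. End v x \<in> set (parity_word 1 (top_word D))) \<or>
        (\<exists>x. End v x \<in> set (parity_word 1 (bot_word D))) \<longrightarrow> v \<in> nodes n)"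
      unfolding parity_diagram_sel by blast
    also have "\<dots> \<longleftrightarrow> ?nodes"
      unfolding End_in_parity_word by blast
    finally show ?thesis .
  qed
  have "(\<exists>!s. s \<in> strings (parity_diagram D) \<and> Node v \<in> s) \<longleftrightarrow>
      (\<exists>!s. s \<in> strings D \<and> Node v \<in> s)" for v
  proof -
    have inj: "inj_on (image (point_rank D)) (strings D)"
      using inj_on_image_Pow[OF inj_on_point_rank] by (rule inj_on_subset) (use strings_subset in blast)
    have mem: "Node v \<in> point_rank D ` s \<longleftrightarrow> Node v \<in> s" if "s \<in> strings D" for s
      using inj_on_image_mem_iff[OF inj_on_point_rank _ strings_subset[OF that], of "Node v"] by simp
    show ?thesis
      unfolding strings_parity_diagram ex1_image_iff[OF inj] using mem by (simp cong: conj_cong)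
  qed
  then show ?thesis
    unfolding is_diagram_def nodes parity_diagram_sel(1)
    by (simp add: noncrossing_parity_diagram cong: conj_cong)
qed

lemma parity_diagram_ghosted_diagram:
  fixes D :: "nat diagram"
  assumes "D \<in> label_diagrams n {0, 1}"
  shows "parity_diagram (ghosted_diagram D) = D"
  using assms by (cases D) (simp add: parity_diagram_def ghosted_diagram_def label_diagrams_def
      parity_word_ghost_word)

lemma bij_betw_parity_diagram:
  "bij_betw parity_diagram (ghost_diagrams n) (label_diagrams n {0, 1})"
proof (rule bij_betwI[where g = ghosted_diagram])
  show "parity_diagram \<in> ghost_diagrams n \<rightarrow> label_diagrams n {0, 1}"
    by (auto dest!: in_set_parity_word simp: ghost_diagrams_def label_diagrams_def is_diagram_parity_diagram)
  show "ghosted_diagram \<in> label_diagrams n {0, 1} \<rightarrow> ghost_diagrams n"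
  proof
    fix D :: "nat diagram" assume D: "D \<in> label_diagrams n {0, 1}"
    then have "is_diagram n (ghosted_diagram D)"
      by (subst is_diagram_parity_diagram[symmetric], subst parity_diagram_ghosted_diagram[OF D])
        (simp add: label_diagrams_def)
    then show "ghosted_diagram D \<in> ghost_diagrams n"
      using odd_length_ghost_word[of 1]
      by (simp add: ghost_diagrams_def ghosted_diagram_def ghost_word_reduced)
  qed
  show "ghosted_diagram (parity_diagram D) = D" if "D \<in> ghost_diagrams n" for D
    using that by (cases D) (simp add: parity_diagram_def ghosted_diagram_def ghost_diagrams_def
      ghost_word_parity_word)
qed (rule parity_diagram_ghosted_diagram)

lemma parity_diagram_id_diagram [simp]: "parity_diagram (id_diagram n) = id_diagram n"
  by (simp add: parity_diagram_def id_diagram_def)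

subsection \<open>Concatenation\<close>

abbreviation cat_rank :: "'x diagram \<Rightarrow> 'x diagram \<Rightarrow> point + point \<Rightarrow> point + point" where
  "cat_rank D1 D2 \<equiv> map_sum (point_rank D1) (point_rank D2)"

abbreviation cat_points :: "'x diagram \<Rightarrow> 'x diagram \<Rightarrow> (point + point) set" where
  "cat_points D1 D2 \<equiv> string_points D1 <+> string_points D2"

lemma inj_on_cat_rank: "inj_on (cat_rank D1 D2) (cat_points D1 D2)"
  by (rule inj_onI) (auto dest: inj_onD[OF inj_on_point_rank])

lemma outer_in_cat_points [simp]: "outer v \<in> cat_points D1 D2"
  by (cases v) auto

lemma cat_rank_outer [simp]: "cat_rank D1 D2 (outer v) = outer v"
  by (cases v) auto

section \<open>The graph of a concatenation and its components\<close>

lemma cat_edges_subset: "e \<in> cat_edges n D1 D2 \<Longrightarrow> e \<subseteq> cat_points D1 D2"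
  unfolding cat_edges_def using strings_subset[of _ D1] strings_subset[of _ D2] by fastforce

lemma cat_edges_doubleton: "\<forall>e\<in>cat_edges n D1 D2. \<exists>p q. e = {p, q}"
  unfolding cat_edges_def using strings_doubleton[of D1] strings_doubleton[of D2] by fastforce

lemma cat_edges_parity_diagram:
  "cat_edges n (parity_diagram D1) (parity_diagram D2) =
     image (cat_rank D1 D2) ` cat_edges n D1 D2"
proof -
  have "image (cat_rank D1 D2) ` {{Inl (Node (Rgt i)), Inr (Node (Lft i))} | i. i \<in> {1..n}} =
      {{Inl (Node (Rgt i)), Inr (Node (Lft i))} | i. i \<in> {1..n}}"
    unfolding Setcompr_eq_image image_image by simp
  then show ?thesis
    unfolding cat_edges_def strings_parity_diagram image_Un image_image by simp
qed

text \<open>The start has to be assumed a string point, since the reflexive closure relates every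
  point to itself, places of ghosts included.\<close>

lemma cat_conn_closed:
  assumes "(p, q) \<in> cat_conn n D1 D2" "p \<in> cat_points D1 D2"
  shows "q \<in> cat_points D1 D2"
  using assms unfolding cat_conn_def
  by (induction rule: rtrancl_induct) (use cat_edges_subset in blast)+

text \<open>The image of a graph can have larger components if vertices are merged. Injectivity of
  \<open>cat_rank\<close> on string points excludes this, so paths lift edge by edge.\<close>

lemma cat_conn_parity_diagram_image:
  assumes "p \<in> cat_points D1 D2"
  shows "cat_conn n (parity_diagram D1) (parity_diagram D2) `` {cat_rank D1 D2 p} =
    cat_rank D1 D2 ` (cat_conn n D1 D2 `` {p})"
proof (intro equalityI subsetI)
  fix q' assume "q' \<in> cat_conn n (parity_diagram D1) (parity_diagram D2) `` {cat_rank D1 D2 p}"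
  then have "(cat_rank D1 D2 p, q') \<in>
      {(p, q). {p, q} \<in> cat_edges n (parity_diagram D1) (parity_diagram D2)}\<^sup>*"
    by (simp add: cat_conn_def)
  then show "q' \<in> cat_rank D1 D2 ` (cat_conn n D1 D2 `` {p})"
  proof (induction rule: rtrancl_induct)
    case base
    show ?case by (auto simp: cat_conn_def)
  next
    case (step q' r')
    then obtain q where q: "(p, q) \<in> cat_conn n D1 D2" "q' = cat_rank D1 D2 q" by auto
    from step have "{q', r'} \<in> image (cat_rank D1 D2) ` cat_edges n D1 D2"
      by (simp add: cat_edges_parity_diagram)
    then obtain s r where sr: "{s, r} \<in> cat_edges n D1 D2"
        "q' = cat_rank D1 D2 s" "r' = cat_rank D1 D2 r"
      using cat_edges_doubleton by (rule doubleton_in_image_image)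
    \<comment> \<open>The lifted edge begins where the lifted path ends, by injectivity.\<close>
    have "s = q"
      using inj_onD[OF inj_on_cat_rank] sr q cat_edges_subset[OF sr(1)]
        cat_conn_closed[OF q(1) assms] by (metis insert_subset)
    with sr q have "(p, r) \<in> cat_conn n D1 D2"
      unfolding cat_conn_def by (blast intro: rtrancl_into_rtrancl)
    with sr show ?case by blast
  qed
next
  fix q' assume "q' \<in> cat_rank D1 D2 ` (cat_conn n D1 D2 `` {p})"
  then obtain q where "(p, q) \<in> {(p, q). {p, q} \<in> cat_edges n D1 D2}\<^sup>*" "q' = cat_rank D1 D2 q"
    by (auto simp: cat_conn_def)
  then have "(cat_rank D1 D2 p, q') \<in>
      {(p, q). {p, q} \<in> cat_edges n (parity_diagram D1) (parity_diagram D2)}\<^sup>*"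
  proof (induction arbitrary: q' rule: rtrancl_induct)
    case (step q r)
    from step.hyps have "cat_rank D1 D2 ` {q, r} \<in> cat_edges n (parity_diagram D1) (parity_diagram D2)"
      by (simp only: cat_edges_parity_diagram) blast
    with step show ?case by (simp add: rtrancl_into_rtrancl)
  qed simp
  then show "q' \<in> cat_conn n (parity_diagram D1) (parity_diagram D2) `` {cat_rank D1 D2 p}"
    by (simp add: cat_conn_def)
qed

lemma cat_conn_parity_diagram_iff:
  assumes "p \<in> cat_points D1 D2" "q \<in> cat_points D1 D2"
  shows "(cat_rank D1 D2 p, cat_rank D1 D2 q) \<in> cat_conn n (parity_diagram D1) (parity_diagram D2)
    \<longleftrightarrow> (p, q) \<in> cat_conn n D1 D2"
proof -
  have "(cat_rank D1 D2 p, cat_rank D1 D2 q) \<in> cat_conn n (parity_diagram D1) (parity_diagram D2)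
      \<longleftrightarrow> cat_rank D1 D2 q \<in> cat_rank D1 D2 ` (cat_conn n D1 D2 `` {p})"
    using cat_conn_parity_diagram_image[OF assms(1), of n] by blast
  also have "\<dots> \<longleftrightarrow> q \<in> cat_conn n D1 D2 `` {p}"
    using cat_conn_closed assms by (intro inj_on_image_mem_iff[OF inj_on_cat_rank]) blast+
  finally show ?thesis by simp
qed

lemma cat_conn_outer_parity_diagram_iff:
  assumes "p \<in> cat_points D1 D2"
  shows "(cat_rank D1 D2 p, outer v) \<in> cat_conn n (parity_diagram D1) (parity_diagram D2)
    \<longleftrightarrow> (p, outer v) \<in> cat_conn n D1 D2"
  using cat_conn_parity_diagram_iff[OF assms, of "outer v" n] by simp

lemma cat_curves_subset:
  assumes "c \<in> cat_curves n D1 D2"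
  shows "c \<subseteq> cat_points D1 D2"
  using assms cat_conn_closed cat_edges_subset
  unfolding cat_curves_def quotient_def by blast

lemma cat_curves_parity_diagram:
  "cat_curves n (parity_diagram D1) (parity_diagram D2) =
     image (cat_rank D1 D2) ` cat_curves n D1 D2"
proof -
  let ?U = "\<Union> (cat_edges n D1 D2)"
  have U: "\<Union> (cat_edges n (parity_diagram D1) (parity_diagram D2)) = cat_rank D1 D2 ` ?U"
    by (auto simp: cat_edges_parity_diagram)
  \<comment> \<open>Seen as the image of the map from a point to its class, the quotient can be
    compared class by class.\<close>
  have classes: "A // R = (\<lambda>x. R `` {x}) ` A" for A :: "'c set" and R
    by (auto simp: quotient_def)
  show ?thesis
    unfolding cat_curves_def U classes image_image
    by (intro image_cong refl cat_conn_parity_diagram_image) (use cat_edges_subset in blast)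
qed

section \<open>Boundary words of products\<close>

lemma cat_top_parity_diagram:
  assumes "even (length (top_word D1))"
  shows "cat_top (parity_diagram D1) (parity_diagram D2) =
    map (cat_rank D1 D2) (at_ends (cat_top D1 D2) (top_word D1 @ top_word D2))"
  unfolding cat_top_def
  by (simp add: at_ends_append at_ends_map o_def
      map_at_ends_parity_word[where f = "\<lambda>i. Inl (Top i)" and k = "Suc 0"]
      map_at_ends_parity_word[where f = "\<lambda>i. Inr (Top i)" and k = "Suc 0"])

lemma cat_bot_parity_diagram:
  assumes "even (length (bot_word D1))"
  shows "cat_bot (parity_diagram D1) (parity_diagram D2) =
    map (cat_rank D1 D2) (at_ends (cat_bot D1 D2) (bot_word D1 @ bot_word D2))"
  unfolding cat_bot_def
  by (simp add: at_ends_append at_ends_map o_def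
      map_at_ends_parity_word[where f = "\<lambda>i. Inl (Bot i)" and k = "Suc 0"]
      map_at_ends_parity_word[where f = "\<lambda>i. Inr (Bot i)" and k = "Suc 0"])

lemma parity_word_append_even:
  "even (length w) \<Longrightarrow> parity_word k (w @ w') = parity_word k w @ parity_word k w'"
  by (simp add: parity_word_append parity_word_add_even)

text \<open>Phrased for pairs of point and letter, the property passes to tails, so inductions on
  two parallel lists can treat top and bottom uniformly.\<close>

lemma cat_top_zip_in_cat_points:
  "\<forall>(p, t) \<in> set (zip (cat_top D1 D2) (top_word D1 @ top_word D2)).
     p \<in> cat_points D1 D2 \<longleftrightarrow> t \<noteq> Ghost"
  by (auto simp: cat_top_def set_zip end_places_def)

lemma cat_bot_zip_in_cat_points:
  "\<forall>(p, t) \<in> set (zip (cat_bot D1 D2) (bot_word D1 @ bot_word D2)).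
     p \<in> cat_points D1 D2 \<longleftrightarrow> t \<noteq> Ghost"
  by (auto simp: cat_bot_def set_zip end_places_def)

lemma length_cat_top [simp]: "length (cat_top D1 D2) = length (top_word D1 @ top_word D2)"
  by (simp add: cat_top_def)

lemma length_cat_bot [simp]: "length (cat_bot D1 D2) = length (bot_word D1 @ bot_word D2)"
  by (simp add: cat_bot_def)

text \<open>Each letter is replaced by exactly one letter on the ghost side, so no number changes. A
  ghost left by an arc then vanishes under \<open>parity_word\<close>, just as the label product
  deletes the arc end outright.\<close>

lemma resolve_parity_word:
  assumes "length ps = length w"
    and "\<forall>(p, t) \<in> set (zip ps w). p \<in> cat_points D1 D2 \<longleftrightarrow> t \<noteq> Ghost"
  shows "parity_word k (concat (map2 (resolve n [Ghost] D1 D2) ps w)) =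
    concat (map2 (resolve n [] (parity_diagram D1) (parity_diagram D2))
      (map (cat_rank D1 D2) (at_ends ps w)) (parity_word k w))"
  using assms
proof (induction ps w arbitrary: k rule: list_induct2)
  case (Cons p ps t w)
  have IH: "parity_word (Suc k) (concat (map2 (resolve n [Ghost] D1 D2) ps w)) =
      concat (map2 (resolve n [] (parity_diagram D1) (parity_diagram D2))
        (map (cat_rank D1 D2) (at_ends ps w)) (parity_word (Suc k) w))"
    using Cons.prems by (intro Cons.IH) simp
  show ?case
  proof (cases t)
    case Ghost
    with IH show ?thesis by (simp add: resolve_def)
  next
    \<comment> \<open>Both the test and the \<open>THE\<close> term in \<open>resolve\<close> depend
      only on connections to outer nodes, which \<open>cat_rank\<close> preserves.\<close>
    case (End v x)
    then have "p \<in> cat_points D1 D2" using Cons.prems by simp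
    with End IH show ?thesis
      by (simp add: resolve_def cat_conn_outer_parity_diagram_iff)
  qed
qed simp

lemma parity_diagram_cat:
  assumes "even (length (top_word D1))" "even (length (bot_word D1))"
  shows "parity_diagram (let D = cat_diagram n [Ghost] D1 D2
      in Diagram (links D) (cancel_ghosts (top_word D)) (cancel_ghosts (bot_word D))) =
    cat_diagram n [] (parity_diagram D1) (parity_diagram D2)"
proof -
  have "(outer u, outer v) \<in> cat_conn n (parity_diagram D1) (parity_diagram D2) \<longleftrightarrow>
      (outer u, outer v) \<in> cat_conn n D1 D2" for u v
    using cat_conn_outer_parity_diagram_iff[OF outer_in_cat_points, of D1 D2 u v] by simp
  then show ?thesis
    using assms
    by (simp add: parity_diagram_def[of "Diagram _ _ _"] cat_diagram_def Let_def
        parity_word_cancel_ghosts resolve_parity_word[OF length_cat_top cat_top_zip_in_cat_points]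
        resolve_parity_word[OF length_cat_bot cat_bot_zip_in_cat_points]
        cat_top_parity_diagram cat_bot_parity_diagram parity_word_append_even)
qed

section \<open>Factors of curves\<close>

lemma ends_on_Nil [simp]: "ends_on c [] = []"
  by (simp add: ends_on_def)

lemma ends_on_Cons [simp]:
  "ends_on c (p # ps) = (if p \<in> c then [0] else []) @ map Suc (ends_on c ps)"
proof -
  have "[0..<length (p # ps)] = 0 # map Suc [0..<length ps]"
    by (simp add: map_Suc_upt upt_conv_Cons del: upt_Suc)
  then show ?thesis
    by (simp add: ends_on_def filter_map o_def del: upt_Suc)
qed

text \<open>The places of the ends of a curve differ between the two sides, but what is read there
  agrees: place \<open>i\<close> has number \<open>i + k\<close> if the first letter has number
  \<open>k\<close>, and its label is the parity of that number.\<close>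

lemma map_label_ends_on:
  assumes "length ps = length w"
    and "\<forall>(p, t) \<in> set (zip ps w). p \<in> cat_points D1 D2 \<longleftrightarrow> t \<noteq> Ghost"
    and "c \<subseteq> cat_points D1 D2"
  shows "map (\<lambda>i. label (parity_word k w ! i))
      (ends_on (cat_rank D1 D2 ` c) (map (cat_rank D1 D2) (at_ends ps w))) =
    map (\<lambda>i. (i + k) mod 2) (ends_on c ps)"
  using assms(1,2)
proof (induction ps w arbitrary: k rule: list_induct2)
  case (Cons p ps t w)
  show ?case
  proof (cases t)
    case Ghost
    with Cons.prems assms(3) have "p \<notin> c" by auto
    with Ghost Cons.IH[of "Suc k"] Cons.prems show ?thesis by (simp add: o_def)
  next
    case (End v x)
    with Cons.prems have "p \<in> cat_points D1 D2" by simp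
    then have "cat_rank D1 D2 p \<in> cat_rank D1 D2 ` c \<longleftrightarrow> p \<in> c"
      using assms(3) by (rule inj_on_image_mem_iff[OF inj_on_cat_rank])
    with End Cons.IH[of "Suc k"] Cons.prems show ?thesis by (simp add: o_def)
  qed
qed simp

text \<open>The cases follow \<open>curve_factor\<close>, which distinguishes lists of length at
  most two and treats longer ones by its default.\<close>

lemma map_eq_map_cases:
  assumes "map f xs = map g ys"
  obtains "xs = []" "ys = []"
  | x y where "xs = [x]" "ys = [y]" "f x = g y"
  | x x' y y' where "xs = [x, x']" "ys = [y, y']" "f x = g y" "f x' = g y'"
  | x x' x'' xs' y y' y'' ys' where "xs = x # x' # x'' # xs'" "ys = y # y' # y'' # ys'"
proof (cases xs)
  case Nil
  with assms that(1) show thesis by simp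
next
  case xs: (Cons x xs1)
  with assms obtain y ys1 where ys: "ys = y # ys1" "f x = g y" "map f xs1 = map g ys1"
    by (cases ys) auto
  show thesis
  proof (cases xs1)
    case Nil
    with xs ys that(2) show thesis by simp
  next
    case xs1: (Cons x' xs2)
    with ys obtain y' ys2 where ys1: "ys1 = y' # ys2" "f x' = g y'" "map f xs2 = map g ys2"
      by (cases ys1) auto
    show thesis
    proof (cases xs2)
      case Nil
      with xs xs1 ys ys1 that(3) show thesis by simp
    next
      case (Cons x'' xs3)
      with ys1 obtain y'' ys3 where "ys2 = y'' # ys3" by (cases ys2) auto
      with Cons xs xs1 ys ys1 that(4) show thesis by simp
    qed
  qed
qed

text \<open>The factor sees places only through the readings \<open>t\<close> and \<open>b\<close>,
  so it agrees for curves whose ends lie at different places but give the same readings.\<close>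

lemma curve_factor_cong:
  assumes "(\<exists>v. outer v \<in> c) \<longleftrightarrow> (\<exists>v. outer v \<in> c')"
    and "map t (ends_on c (cat_top D1 D2)) = map t' (ends_on c' (cat_top D1' D2'))"
    and "map b (ends_on c (cat_bot D1 D2)) = map b' (ends_on c' (cat_bot D1' D2'))"
  shows "curve_factor \<beta> (\<lambda>i j. \<alpha> (t i) (t j)) (\<lambda>i j. \<delta> (b i) (b j)) (\<lambda>i j. \<gamma> (t i) (b j)) D1 D2 c =
    curve_factor \<beta> (\<lambda>i j. \<alpha> (t' i) (t' j)) (\<lambda>i j. \<delta> (b' i) (b' j)) (\<lambda>i j. \<gamma> (t' i) (b' j)) D1' D2' c'"
  using assms(2)
proof (cases rule: map_eq_map_cases)
  case 1
  from assms(3) show ?thesis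
    by (cases rule: map_eq_map_cases) (use 1 assms(1) in \<open>simp_all add: curve_factor_def\<close>)
next
  case 2
  from assms(3) show ?thesis
    by (cases rule: map_eq_map_cases) (use 2 assms(1) in \<open>simp_all add: curve_factor_def\<close>)
next
  case 3
  from assms(3) show ?thesis
    by (cases rule: map_eq_map_cases) (use 3 assms(1) in \<open>simp_all add: curve_factor_def\<close>)
next
  \<comment> \<open>With three or more ends on top the factor is 1 on both sides.\<close>
  case 4
  with assms(1) show ?thesis by (simp add: curve_factor_def)
qed

lemma parity_factor_eq:
  assumes "f 1 0 = x" "f 0 1 = y" "f 1 1 = z" "f 0 0 = z"
  shows "parity_factor x y z = (\<lambda>i j. f (Suc i mod 2) (Suc j mod 2))"
  using assms by (auto simp: fun_eq_iff parity_factor_def mod2_eq_if)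

lemma prod_curve_factor_parity_diagram:
  assumes "even (length (top_word D1))" "even (length (bot_word D1))"
  shows "(\<Prod>c \<in> cat_curves n D1 D2.
      curve_factor \<beta> (\<lambda>i j. \<alpha> (Suc i mod 2) (Suc j mod 2)) (\<lambda>i j. \<delta> (Suc i mod 2) (Suc j mod 2))
        (\<lambda>i j. \<gamma> (Suc i mod 2) (Suc j mod 2)) D1 D2 c) =
    (let t = (\<lambda>i. label ((top_word (parity_diagram D1) @ top_word (parity_diagram D2)) ! i));
         b = (\<lambda>i. label ((bot_word (parity_diagram D1) @ bot_word (parity_diagram D2)) ! i))
     in \<Prod>c \<in> cat_curves n (parity_diagram D1) (parity_diagram D2).
          curve_factor \<beta> (\<lambda>i j. \<alpha> (t i) (t j)) (\<lambda>i j. \<delta> (b i) (b j)) (\<lambda>i j. \<gamma> (t i) (b j))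
            (parity_diagram D1) (parity_diagram D2) c)"
proof -
  let ?D1 = "parity_diagram D1" and ?D2 = "parity_diagram D2" and ?r = "cat_rank D1 D2"
  let ?t = "\<lambda>i. label ((top_word ?D1 @ top_word ?D2) ! i)"
    and ?b = "\<lambda>i. label ((bot_word ?D1 @ bot_word ?D2) ! i)"
  \<comment> \<open>Different curves have different images, so the product can be reindexed without
    losing factors.\<close>
  have "inj_on (image ?r) (cat_curves n D1 D2)"
    using inj_on_image_Pow[OF inj_on_cat_rank]
    by (rule inj_on_subset) (use cat_curves_subset in blast)
  then have "(\<Prod>c \<in> cat_curves n ?D1 ?D2.
        curve_factor \<beta> (\<lambda>i j. \<alpha> (?t i) (?t j)) (\<lambda>i j. \<delta> (?b i) (?b j)) (\<lambda>i j. \<gamma> (?t i) (?b j))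
          ?D1 ?D2 c) =
      (\<Prod>c \<in> cat_curves n D1 D2.
        curve_factor \<beta> (\<lambda>i j. \<alpha> (?t i) (?t j)) (\<lambda>i j. \<delta> (?b i) (?b j)) (\<lambda>i j. \<gamma> (?t i) (?b j))
          ?D1 ?D2 (?r ` c))"
    unfolding cat_curves_parity_diagram by (simp add: prod.reindex)
  also have "\<dots> = (\<Prod>c \<in> cat_curves n D1 D2.
      curve_factor \<beta> (\<lambda>i j. \<alpha> (Suc i mod 2) (Suc j mod 2)) (\<lambda>i j. \<delta> (Suc i mod 2) (Suc j mod 2))
        (\<lambda>i j. \<gamma> (Suc i mod 2) (Suc j mod 2)) D1 D2 c)"
  proof (rule prod.cong[OF refl], rule curve_factor_cong)
    fix c assume "c \<in> cat_curves n D1 D2"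
    then have c: "c \<subseteq> cat_points D1 D2" by (rule cat_curves_subset)
    have "outer v \<in> ?r ` c \<longleftrightarrow> outer v \<in> c" for v
      using inj_on_image_mem_iff[OF inj_on_cat_rank outer_in_cat_points c, of v] by simp
    then show "(\<exists>v. outer v \<in> ?r ` c) \<longleftrightarrow> (\<exists>v. outer v \<in> c)" by simp
    show "map ?t (ends_on (?r ` c) (cat_top ?D1 ?D2)) =
        map (\<lambda>i. Suc i mod 2) (ends_on c (cat_top D1 D2))"
      using map_label_ends_on[OF length_cat_top cat_top_zip_in_cat_points c, where k = 1] assms
      by (simp add: cat_top_parity_diagram parity_word_append_even)
    show "map ?b (ends_on (?r ` c) (cat_bot ?D1 ?D2)) =
        map (\<lambda>i. Suc i mod 2) (ends_on c (cat_bot D1 D2))"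
      using map_label_ends_on[OF length_cat_bot cat_bot_zip_in_cat_points c, where k = 1] assms
      by (simp add: cat_bot_parity_diagram parity_word_append_even)
  qed
  finally show ?thesis by (simp add: Let_def)
qed

subsection \<open>Algebras with corresponding bases\<close>

text \<open>The linear extension of the map \<open>F\<close> of basis elements.\<close>

definition relabel_basis :: "('a \<Rightarrow> 'b) \<Rightarrow> ('a \<Rightarrow>\<^sub>0 'k::field) \<Rightarrow> 'b \<Rightarrow>\<^sub>0 'k" where
  "relabel_basis F f =
     (\<Sum>x \<in> Poly_Mapping.keys f. Poly_Mapping.single (F x) (Poly_Mapping.lookup f x))"

text \<open>Supports can shrink under addition and scaling; a larger index set allows sums to be
  compared term by term.\<close>

lemma relabel_basis_superset:
  assumes "finite S" "Poly_Mapping.keys f \<subseteq> S"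
  shows "relabel_basis F f = (\<Sum>x \<in> S. Poly_Mapping.single (F x) (Poly_Mapping.lookup f x))"
  unfolding relabel_basis_def using assms
  by (intro sum.mono_neutral_left) (auto simp: in_keys_iff)

lemma relabel_basis_single [simp]:
  "relabel_basis F (Poly_Mapping.single x s) = Poly_Mapping.single (F x) s"
  by (subst relabel_basis_superset[of "{x}"]) auto

lemma relabel_basis_zero [simp]: "relabel_basis F 0 = 0"
  by (simp add: relabel_basis_def)

lemma relabel_basis_add:
  fixes f g :: "'a \<Rightarrow>\<^sub>0 'k::field"
  shows "relabel_basis F (f + g) = relabel_basis F f + relabel_basis F g"
proof -
  let ?S = "Poly_Mapping.keys f \<union> Poly_Mapping.keys g"
  have "relabel_basis F h = (\<Sum>x \<in> ?S. Poly_Mapping.single (F x) (Poly_Mapping.lookup h x))"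
    if "Poly_Mapping.keys h \<subseteq> ?S" for h :: "'a \<Rightarrow>\<^sub>0 'k"
    using that by (intro relabel_basis_superset) auto
  then show ?thesis
    using Poly_Mapping.keys_add[of f g]
    by (simp add: lookup_add single_add sum.distrib)
qed

lemma relabel_basis_sum: "relabel_basis F (\<Sum>i \<in> I. f i) = (\<Sum>i \<in> I. relabel_basis F (f i))"
  by (induction I rule: infinite_finite_induct) (simp_all add: relabel_basis_add)

lemma lookup_smult:
  "Poly_Mapping.lookup (Poly_Mapping.map (\<lambda>t. s * t) f) x = s * Poly_Mapping.lookup f x"
  for s :: "'k::field"
  by (simp add: Poly_Mapping.map.rep_eq when_def)

lemma smult_single:
  "Poly_Mapping.map (\<lambda>t. s * t) (Poly_Mapping.single x r) = Poly_Mapping.single x (s * r :: 'k::field)"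
  by (rule poly_mapping_eqI) (simp add: lookup_smult lookup_single when_def)

lemma smult_sum:
  "Poly_Mapping.map (\<lambda>t. s * t) (\<Sum>i \<in> I. f i :: 'a \<Rightarrow>\<^sub>0 'k::field) =
     (\<Sum>i \<in> I. Poly_Mapping.map (\<lambda>t. s * t) (f i))"
  by (rule poly_mapping_eqI)
    (simp add: lookup_smult lookup_sum sum_distrib_left)

lemma relabel_basis_smult:
  "relabel_basis F (Poly_Mapping.map (\<lambda>t. s * t) f) =
     Poly_Mapping.map (\<lambda>t. s * t) (relabel_basis F f)"
proof -
  have "Poly_Mapping.keys (Poly_Mapping.map (\<lambda>t. s * t) f) \<subseteq> Poly_Mapping.keys f"
    by (auto simp: in_keys_iff lookup_smult)
  then show ?thesis
    by (subst relabel_basis_superset[of "Poly_Mapping.keys f"])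
      (simp_all add: relabel_basis_def smult_sum smult_single lookup_smult)
qed

lemma lookup_relabel_basis:
  assumes "inj_on F B" "Poly_Mapping.keys f \<subseteq> B" "x \<in> B"
  shows "Poly_Mapping.lookup (relabel_basis F f) (F x) = Poly_Mapping.lookup f x"
proof -
  have "Poly_Mapping.lookup (relabel_basis F f) (F x) =
      (\<Sum>y \<in> Poly_Mapping.keys f. if y = x then Poly_Mapping.lookup f y else 0)"
    unfolding relabel_basis_def lookup_sum lookup_single when_def
    using assms by (intro sum.cong) (auto dest: inj_onD)
  then show ?thesis by (simp add: in_keys_iff)
qed

text \<open>Injectivity keeps coefficients from being added up and possibly cancelling. The exact
  support is what lets the sums in a product be reindexed along \<open>F\<close>.\<close>

lemma keys_relabel_basis:
  assumes "inj_on F B" "Poly_Mapping.keys f \<subseteq> B"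
  shows "Poly_Mapping.keys (relabel_basis F f) = F ` Poly_Mapping.keys f"
proof
  show "Poly_Mapping.keys (relabel_basis F f) \<subseteq> F ` Poly_Mapping.keys f"
    unfolding relabel_basis_def by (rule order.trans[OF keys_sum]) auto
  show "F ` Poly_Mapping.keys f \<subseteq> Poly_Mapping.keys (relabel_basis F f)"
    using lookup_relabel_basis[OF assms] assms(2) by (auto simp: in_keys_iff)
qed

lemma bij_betw_relabel_basis:
  fixes F :: "'a \<Rightarrow> 'b"
  assumes "bij_betw F B B'"
  shows "bij_betw (relabel_basis F)
    {f. Poly_Mapping.keys f \<subseteq> B} {f :: 'b \<Rightarrow>\<^sub>0 'k::field. Poly_Mapping.keys f \<subseteq> B'}"
proof -
  let ?G = "inv_into B F"
  have inj: "inj_on F B" and img: "F ` B = B'"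
    using assms by (auto simp: bij_betw_def)
  \<comment> \<open>Stated for arbitrary maps so as to cover both composites of \<open>F\<close> and
    its inverse.\<close>
  have inv: "relabel_basis h (relabel_basis g f) = f"
    if "\<And>x. x \<in> Poly_Mapping.keys f \<Longrightarrow> h (g x) = x" for h g and f :: "'c \<Rightarrow>\<^sub>0 'k"
  proof -
    have "relabel_basis h (relabel_basis g f) = relabel_basis id f"
      unfolding relabel_basis_def[of g] relabel_basis_def[of id] relabel_basis_sum
      using that by (intro sum.cong) auto
    also have "\<dots> = f"
      using lookup_relabel_basis[of id UNIV f] by (intro poly_mapping_eqI) simp
    finally show ?thesis .
  qed
  have keys: "Poly_Mapping.keys (relabel_basis g f) \<subseteq> g ` Poly_Mapping.keys f"
    for g and f :: "'c \<Rightarrow>\<^sub>0 'k"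
    unfolding relabel_basis_def by (rule order.trans[OF keys_sum]) auto
  show ?thesis
  proof (rule bij_betwI[where g = "relabel_basis ?G"])
    show "relabel_basis F \<in> {f :: 'a \<Rightarrow>\<^sub>0 'k. Poly_Mapping.keys f \<subseteq> B} \<rightarrow> {f. Poly_Mapping.keys f \<subseteq> B'}"
    proof
      fix f :: "'a \<Rightarrow>\<^sub>0 'k" assume "f \<in> {f. Poly_Mapping.keys f \<subseteq> B}"
      then show "relabel_basis F f \<in> {f. Poly_Mapping.keys f \<subseteq> B'}"
        using keys[of F f] img image_mono[of "Poly_Mapping.keys f" B F] by blast
    qed
    show "relabel_basis ?G \<in> {f :: 'b \<Rightarrow>\<^sub>0 'k. Poly_Mapping.keys f \<subseteq> B'} \<rightarrow> {f. Poly_Mapping.keys f \<subseteq> B}"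
    proof
      fix f :: "'b \<Rightarrow>\<^sub>0 'k" assume "f \<in> {f. Poly_Mapping.keys f \<subseteq> B'}"
      then show "relabel_basis ?G f \<in> {f. Poly_Mapping.keys f \<subseteq> B}"
        using keys[of ?G f] img inv_into_into[of _ F B] by blast
    qed
  qed (use inj img in \<open>auto intro!: inv simp: f_inv_into_f subset_iff\<close>)
qed

lemma based_algebra_isomorphic:
  fixes c :: "'a \<Rightarrow> 'a \<Rightarrow> 'k::field"
  assumes "bij_betw F B B'" "F e = e'"
    and m: "\<And>x y. x \<in> B \<Longrightarrow> y \<in> B \<Longrightarrow> F (m x y) = m' (F x) (F y)"
    and c: "\<And>x y. x \<in> B \<Longrightarrow> y \<in> B \<Longrightarrow> c x y = c' (F x) (F y)"
  shows "algebra_isomorphic (based_algebra B e m c) (based_algebra B' e' m' c')"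
proof -
  let ?A = "based_algebra B e m c" and ?A' = "based_algebra B' e' m' c'" and ?\<phi> = "relabel_basis F"
  have inj: "inj_on F B" using assms(1) by (simp add: bij_betw_def)
  have bij: "bij_betw ?\<phi> (carrier ?A) (carrier ?A')"
    using bij_betw_relabel_basis[OF assms(1)] by (simp add: based_algebra_def)
  have mult: "?\<phi> (f \<otimes>\<^bsub>?A\<^esub> g) = ?\<phi> f \<otimes>\<^bsub>?A'\<^esub> ?\<phi> g"
    if "f \<in> carrier ?A" "g \<in> carrier ?A" for f g
  proof -
    from that have f: "Poly_Mapping.keys f \<subseteq> B" and g: "Poly_Mapping.keys g \<subseteq> B"
      by (simp_all add: based_algebra_def)
    have "?\<phi> (f \<otimes>\<^bsub>?A\<^esub> g) = (\<Sum>x \<in> Poly_Mapping.keys f. \<Sum>y \<in> Poly_Mapping.keys g.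
        Poly_Mapping.single (F (m x y)) (Poly_Mapping.lookup f x * Poly_Mapping.lookup g y * c x y))"
      by (simp add: based_algebra_def relabel_basis_sum)
    also have "\<dots> = (\<Sum>x \<in> Poly_Mapping.keys f. \<Sum>y \<in> Poly_Mapping.keys g.
        Poly_Mapping.single (m' (F x) (F y))
          (Poly_Mapping.lookup (?\<phi> f) (F x) * Poly_Mapping.lookup (?\<phi> g) (F y) * c' (F x) (F y)))"
      using f g
      by (intro sum.cong refl)
        (simp add: m c subsetD lookup_relabel_basis[OF inj f] lookup_relabel_basis[OF inj g])
    \<comment> \<open>The sums over the supports of \<open>f\<close> and \<open>g\<close> become
      sums over their images under \<open>F\<close>.\<close>
    also have "\<dots> = ?\<phi> f \<otimes>\<^bsub>?A'\<^esub> ?\<phi> g"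
      using inj_on_subset[OF inj f] inj_on_subset[OF inj g]
      by (simp add: based_algebra_def keys_relabel_basis[OF inj] f g sum.reindex)
    finally show ?thesis .
  qed
  have "?\<phi> \<in> ring_iso ?A ?A'"
    unfolding ring_iso_def ring_hom_def
    using bij mult assms(2)
    by (auto simp: bij_betw_def) (simp_all add: based_algebra_def relabel_basis_add)
  then show ?thesis
    unfolding algebra_isomorphic_def
    by (rule bexI[rotated]) (simp add: based_algebra_def relabel_basis_smult)
qed

theorem proposition2p2:
  fixes n :: nat and \<alpha> \<delta> \<gamma> :: "nat \<Rightarrow> nat \<Rightarrow> ground"
  assumes "n \<ge> 1"
    and "\<alpha> 1 0 = indet Alpha1" and "\<alpha> 0 1 = indet Alpha2"
    and "\<alpha> 1 1 = indet Alpha3" and "\<alpha> 0 0 = indet Alpha3"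
    and "\<delta> 1 0 = indet Delta1" and "\<delta> 0 1 = indet Delta2"
    and "\<delta> 1 1 = indet Delta3" and "\<delta> 0 0 = indet Delta3"
    and "\<gamma> 1 0 = indet Gamma12" and "\<gamma> 0 1 = indet Gamma12"
    and "\<gamma> 1 1 = indet Gamma3" and "\<gamma> 0 0 = indet Gamma3"
  shows "algebra_isomorphic
    (ghost_algebra n (indet Beta) (indet Alpha1) (indet Alpha2) (indet Alpha3)
       (indet Delta1) (indet Delta2) (indet Delta3) (indet Gamma12) (indet Gamma3))
    (label_algebra n {0, 1} (indet Beta) \<alpha> \<delta> \<gamma>)"
  \<comment> \<open>The ghost factors become the label factors evaluated at parities of numbers,
    with label 1 for odd; the two mixed values of \<open>\<gamma>\<close> coincide.\<close>
  unfolding ghost_algebra_def label_algebra_def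
    parity_factor_eq[of \<alpha>, OF assms(2-5)] parity_factor_eq[of \<delta>, OF assms(6-9)]
    parity_factor_eq[of \<gamma>, OF assms(10-13)]
proof (rule based_algebra_isomorphic)
  show "bij_betw parity_diagram (ghost_diagrams n) (label_diagrams n {0, 1})"
    by (rule bij_betw_parity_diagram)
  show "parity_diagram (id_diagram n) = id_diagram n" by simp
next
  fix D1 D2 assume "D1 \<in> ghost_diagrams n"
  then have even: "even (length (top_word D1))" "even (length (bot_word D1))"
    by (simp_all add: ghost_diagrams_def)
  show "parity_diagram (let D = cat_diagram n [Ghost] D1 D2
      in Diagram (links D) (cancel_ghosts (top_word D)) (cancel_ghosts (bot_word D))) =
    cat_diagram n [] (parity_diagram D1) (parity_diagram D2)"
    using even by (rule parity_diagram_cat)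
  note prod_curve_factor_parity_diagram[OF even]
  then show "(\<Prod>c \<in> cat_curves n D1 D2.
      curve_factor (indet Beta) (\<lambda>i j. \<alpha> (Suc i mod 2) (Suc j mod 2))
        (\<lambda>i j. \<delta> (Suc i mod 2) (Suc j mod 2)) (\<lambda>i j. \<gamma> (Suc i mod 2) (Suc j mod 2)) D1 D2 c) =
    (let t = (\<lambda>i. label ((top_word (parity_diagram D1) @ top_word (parity_diagram D2)) ! i));
         b = (\<lambda>i. label ((bot_word (parity_diagram D1) @ bot_word (parity_diagram D2)) ! i))
     in \<Prod>c \<in> cat_curves n (parity_diagram D1) (parity_diagram D2).
          curve_factor (indet Beta) (\<lambda>i j. \<alpha> (t i) (t j)) (\<lambda>i j. \<delta> (b i) (b j))
            (\<lambda>i j. \<gamma> (t i) (b j)) (parity_diagram D1) (parity_diagram D2) c)" .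
qed

end
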